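(* For all positive integers $d,n$ with $d+1\le n\le 2^d$, there is a $d$-dimensional 0/1-polytope with $n$ vertices, at most $(d+4)n$ edges, and whose graph has edge expansion at least one.
   Context: A 0/1-polytope is the convex hull of a set of points in $\{0,1\}^m$ for some $m$. The graph of a polytope has as nodes the vertices of the polytope and as edges its one-dimensional faces. The edge expansion of a graph $G=(V,E)$ is $$\min\left\{\frac{|\delta(T)|}{|T|} : T\subset V,\ 0<|T|\le\frac{|V|}{2}\right\},$$ where $\delta(T)$ denotes the set of all edges with one end node in $T$ and the other one in $V\setminus T$. *)

theory Defs
  imports "HOL-Analysis.Analysis" "HOL-Analysis.Finite_Function_Topology"
begin

text \<open>
  The ambient dimension \<open>m\<close> of a 0/1-polytope is existentially quantified, so it cannot be a
  type. All spaces \<open>\<real>\<^sup>m\<close> are therefore taken inside the real vector space of finitely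
  supported sequences: \<open>\<real>\<^sup>m\<close> is the subspace of the sequences that vanish at every index
  \<open>i \<ge> m\<close>.
\<close>

definition zero_one_points :: "nat \<Rightarrow> (nat \<Rightarrow>\<^sub>0 real) set" where
  "zero_one_points m =
     {x. (\<forall>i<m. Poly_Mapping.lookup x i \<in> {0, 1}) \<and> (\<forall>i\<ge>m. Poly_Mapping.lookup x i = 0)}"

definition zero_one_polytope :: "(nat \<Rightarrow>\<^sub>0 real) set \<Rightarrow> bool" where
  "zero_one_polytope P \<longleftrightarrow> (\<exists>m. \<exists>S \<subseteq> zero_one_points m. P = convex hull S)"

text \<open>
  The library constants \<^const>\<open>aff_dim\<close> and \<^const>\<open>edge_of\<close> are restricted to
  Euclidean spaces. The following versions make sense in every real vector space, and the lemmas
  below show that they agree with the library on Euclidean spaces.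
\<close>

definition affine_dimension :: "'a::real_vector set \<Rightarrow> int" where
  "affine_dimension S = (if S = {} then -1 else int (dim {x - y |x y. x \<in> S \<and> y \<in> S}))"

definition polytope_vertices :: "'a::real_vector set \<Rightarrow> 'a set" where
  "polytope_vertices P = {v. v extreme_point_of P}"

definition polytope_edges :: "'a::real_vector set \<Rightarrow> 'a set set" where
  "polytope_edges P = {F. F face_of P \<and> affine_dimension F = 1}"

text \<open>
  In the graph of a polytope, an edge is recorded as the set of its two end nodes: a
  one-dimensional face \<open>F\<close> of a polytope is a segment whose end points are the vertices
  of \<open>F\<close>.
\<close>

definition polytope_graph_edges :: "'a::real_vector set \<Rightarrow> 'a set set" where
  "polytope_graph_edges P = polytope_vertices ` polytope_edges P"

definition cut_edges :: "'v set \<Rightarrow> 'v set set \<Rightarrow> 'v set \<Rightarrow> 'v set set" where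
  "cut_edges V E T = {e \<in> E. \<exists>u \<in> T. \<exists>v \<in> V - T. e = {u, v}}"

text \<open>Only meaningful for a finite graph with at least two nodes (otherwise the minimum is
  taken over the empty set).\<close>

definition edge_expansion :: "'v set \<Rightarrow> 'v set set \<Rightarrow> real" where
  "edge_expansion V E =
     Min {real (card (cut_edges V E T)) / real (card T) |T.
            T \<subseteq> V \<and> 0 < card T \<and> real (card T) \<le> real (card V) / 2}"

lemma affine_dimension_eq_aff_dim:
  fixes S :: "'a::euclidean_space set"
  shows "affine_dimension S = aff_dim S"
proof (cases "S = {}")
  case False
  then obtain a where a: "a \<in> S" by blast
  let ?D = "{x - y |x y. x \<in> S \<and> y \<in> S}" and ?A = "(+) (- a) ` S"
  have "x - y \<in> span ?A" if "x \<in> S" "y \<in> S" for x y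
  proof -
    have "(- a + x) - (- a + y) \<in> span ?A"
      using that by (intro span_diff span_base) auto
    then show ?thesis by simp
  qed
  then have "?D \<subseteq> span ?A" by blast
  moreover have "?A \<subseteq> ?D"
  proof
    fix z assume "z \<in> ?A"
    then obtain x where "x \<in> S" "z = x - a" by auto
    then show "z \<in> ?D" using a by blast
  qed
  then have "?A \<subseteq> span ?D"
    using span_superset by blast
  ultimately have "span ?D = span ?A"
    unfolding span_eq by blast
  then have "dim ?D = dim ?A"
    using dim_span[of ?D] dim_span[of ?A] by presburger
  moreover have "aff_dim S = int (dim ?A)"
    using a by (intro aff_dim_eq_dim hull_inc)
  ultimately show ?thesis
    using False by (simp add: affine_dimension_def)
qed (simp add: affine_dimension_def)

lemma polytope_edges_eq_edge_of:
  fixes P :: "'a::euclidean_space set"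
  shows "polytope_edges P = {F. F edge_of P}"
  by (simp add: polytope_edges_def edge_of_def affine_dimension_eq_aff_dim)

end

theory Submission
  imports Defs
begin

text \<open>
  Read a natural number below \<open>2 ^ d\<close> as a vertex of the \<open>d\<close>-dimensional cube, through its bits. For
  \<open>n > 2 ^ (d - 1)\<close> the polytope is the convex hull of the first \<open>n\<close> numbers. It is
  \<open>d\<close>-dimensional because it contains the origin and all unit vectors. The other two properties
  follow by splitting the numbers by their lowest bit, which produces two copies of
  shorter initial segments, with sizes that differ by at most one.

  Expansion: two vertices that differ in one coordinate span a cube edge, and this is an edge of
  the polytope. These edges alone suffice (\<open>cube_expanding_initial\<close>). Both halves expand by
  induction, and flipping the lowest bit is a matching between them that misses at most one node;
  if a set of nodes fills one half more than the other, the matching edges supply what the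
  two halves do not.

  Number of edges: if \<open>x + y = u + v\<close> for two different pairs of vertices, neither pair is an
  edge, as the two segments have a common midpoint. So it suffices to count the pairs
  with a unique sum (\<open>card_unique_sum_pairs_initial\<close>). Exchanging the lowest bits of an even and
  an odd number preserves the sum, and this leaves at most \<open>n\<close> pairs of different parity. Over all
  bits, this gives at most \<open>d * n\<close> edges.

  For \<open>n \<le> 2 ^ (d - 1)\<close>, take a pyramid over a polytope for \<open>d - 1\<close> and \<open>n - 1\<close>: the edges at
  the apex already give the expansion, and there are only \<open>n - 1\<close> of them
  (\<open>vertex_code_exists\<close>).

  The link to geometry consists of linear functionals, which certify the vertices and the
  required edges (\<open>bit_polytope_supporting_face\<close>), and of the fact that an edge of a 0/1-polytope
  contains exactly two 0/1-points (\<open>edge_bit_polytope\<close>).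
\<close>

section \<open>Bit patterns\<close>

lemma not_bit_if_less_power:
  fixes x :: nat
  assumes "x < 2 ^ d" and "d \<le> i"
  shows "\<not> bit x i"
proof -
  have "x < 2 ^ i"
    using assms by (meson less_le_trans one_le_numeral power_increasing)
  then show ?thesis
    by (simp add: bit_iff_odd)
qed

lemma eq_if_low_bits_eq:
  fixes x y :: nat
  assumes "x < 2 ^ d" "y < 2 ^ d" and "\<And>i. i < d \<Longrightarrow> bit x i = bit y i"
  shows "x = y"
  using assms not_bit_if_less_power by (metis bit_eqI linorder_not_less)

lemma bit_double: "bit (2 * x) i \<longleftrightarrow> i \<noteq> 0 \<and> bit x (i - 1)" for x :: nat
  by (cases i) (auto simp: bit_0 bit_Suc)

lemma bit_double_plus_1: "bit (Suc (2 * x)) i \<longleftrightarrow> i = 0 \<or> bit x (i - 1)" for x :: nat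
  by (cases i) (auto simp: bit_0 bit_Suc)

section \<open>Expansion at least one\<close>

definition cut_pairs :: "('v \<Rightarrow> 'v \<Rightarrow> bool) \<Rightarrow> 'v set \<Rightarrow> 'v set \<Rightarrow> ('v \<times> 'v) set" where
  "cut_pairs R S T = {(u, v). u \<in> T \<and> v \<in> S - T \<and> R u v}"

text \<open>
  Edge expansion at least one, in a form symmetric in \<open>T\<close> and \<open>S - T\<close>: an induction over two halves
  of the node set meets sets that contain more than half of one of them, and it ends at graphs
  with a single node.
\<close>

definition expanding :: "('v \<Rightarrow> 'v \<Rightarrow> bool) \<Rightarrow> 'v set \<Rightarrow> bool" where
  "expanding R S \<longleftrightarrow> (\<forall>T\<subseteq>S. min (card T) (card S - card T) \<le> card (cut_pairs R S T))"

lemma finite_cut_pairs: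
  assumes "finite S" and "T \<subseteq> S"
  shows "finite (cut_pairs R S T)"
proof (rule finite_subset)
  show "cut_pairs R S T \<subseteq> S \<times> S"
    using assms by (auto simp: cut_pairs_def)
qed (use assms in simp)

lemma expanding_image:
  assumes "expanding R S" and inj: "inj_on f S" and "finite S"
    and adj: "\<And>x y. x \<in> S \<Longrightarrow> y \<in> S \<Longrightarrow> x \<noteq> y \<Longrightarrow> R x y \<Longrightarrow> R' (f x) (f y)"
  shows "expanding R' (f ` S)"
  unfolding expanding_def
proof (intro allI impI)
  fix T assume "T \<subseteq> f ` S"
  then obtain T' where T': "T' \<subseteq> S" "T = f ` T'"
    by (meson subset_imageE)
  have sub: "map_prod f f ` cut_pairs R S T' \<subseteq> cut_pairs R' (f ` S) T"
  proof (rule image_subsetI)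
    fix z assume "z \<in> cut_pairs R S T'"
    then obtain x y where z: "z = (x, y)" and xy: "x \<in> T'" "y \<in> S" "y \<notin> T'" "R x y"
      by (auto simp: cut_pairs_def)
    have "f y \<notin> T"
      using inj_on_image_mem_iff[OF inj xy(2) T'(1)] xy(3) T'(2) by simp
    moreover have "R' (f x) (f y)"
      using adj xy T'(1) by blast
    ultimately show "map_prod f f z \<in> cut_pairs R' (f ` S) T"
      using xy T'(2) by (simp add: cut_pairs_def z)
  qed
  have "cut_pairs R S T' \<subseteq> S \<times> S"
    using T' by (auto simp: cut_pairs_def)
  then have "card (map_prod f f ` cut_pairs R S T') = card (cut_pairs R S T')"
    using inj by (intro card_image inj_on_subset[OF map_prod_inj_on]) auto
  moreover have "finite (cut_pairs R' (f ` S) T)"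
    using assms(3) \<open>T \<subseteq> f ` S\<close> by (intro finite_cut_pairs) auto
  ultimately have "card (cut_pairs R S T') \<le> card (cut_pairs R' (f ` S) T)"
    using card_mono sub by metis
  moreover have "card T = card T'" "card (f ` S) = card S"
    using T' inj by (auto intro: card_image inj_on_subset)
  ultimately show "min (card T) (card (f ` S) - card T) \<le> card (cut_pairs R' (f ` S) T)"
    using assms(1) T'(1) unfolding expanding_def by (metis le_trans)
qed

corollary expanding_mono:
  assumes "expanding R S" and "finite S"
    and "\<And>x y. x \<in> S \<Longrightarrow> y \<in> S \<Longrightarrow> x \<noteq> y \<Longrightarrow> R x y \<Longrightarrow> R' x y"
  shows "expanding R' S"
  using expanding_image[of R S id R'] assms by simp

text \<open>
  Every node on the other side of the cut from \<open>a\<close> contributes its edge to \<open>a\<close>.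
\<close>

lemma expanding_apex:
  assumes fin: "finite S" and a: "a \<notin> S"
    and adj: "\<And>x. x \<in> S \<Longrightarrow> R x a" "\<And>x. x \<in> S \<Longrightarrow> R a x"
  shows "expanding R (insert a S)"
  unfolding expanding_def
proof (intro allI impI)
  fix T assume T: "T \<subseteq> insert a S"
  let ?C = "cut_pairs R (insert a S) T"
  have finT: "finite T" and finC: "finite ?C"
    using T fin finite_subset finite_cut_pairs[of "insert a S" T] by auto
  show "min (card T) (card (insert a S) - card T) \<le> card ?C"
  proof (cases "a \<in> T")
    case True
    then have "(\<lambda>v. (a, v)) ` (insert a S - T) \<subseteq> ?C"
      using adj by (auto simp: cut_pairs_def)
    then have "card ((\<lambda>v. (a, v)) ` (insert a S - T)) \<le> card ?C"
      using finC by (rule card_mono[rotated])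
    then have "card (insert a S - T) \<le> card ?C"
      by (simp add: card_image inj_on_def)
    then show ?thesis
      using card_Diff_subset[OF finT T] by simp
  next
    case False
    then have "(\<lambda>u. (u, a)) ` T \<subseteq> ?C"
      using adj T by (auto simp: cut_pairs_def)
    then have "card ((\<lambda>u. (u, a)) ` T) \<le> card ?C"
      using finC by (rule card_mono[rotated])
    then show ?thesis
      by (simp add: card_image inj_on_def)
  qed
qed

section \<open>The cube graph on an initial segment of the naturals\<close>

definition cube_adjacent :: "nat \<Rightarrow> nat \<Rightarrow> bool" where
  "cube_adjacent x y \<longleftrightarrow> (\<exists>i. \<forall>j. bit x j \<noteq> bit y j \<longleftrightarrow> j = i)"

lemma cube_adjacent_double:
  assumes "cube_adjacent x y"
  shows "cube_adjacent (2 * x) (2 * y)" and "cube_adjacent (Suc (2 * x)) (Suc (2 * y))"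
proof -
  obtain i where i: "\<And>j. bit x j \<noteq> bit y j \<longleftrightarrow> j = i"
    using assms by (auto simp: cube_adjacent_def)
  have "bit (2 * x) j \<noteq> bit (2 * y) j \<longleftrightarrow> j = Suc i"
    and "bit (Suc (2 * x)) j \<noteq> bit (Suc (2 * y)) j \<longleftrightarrow> j = Suc i" for j
    using i by (cases j; simp add: bit_double bit_double_plus_1)+
  then show "cube_adjacent (2 * x) (2 * y)" "cube_adjacent (Suc (2 * x)) (Suc (2 * y))"
    unfolding cube_adjacent_def by blast+
qed

lemma cube_adjacent_vertical:
  "cube_adjacent (2 * x) (Suc (2 * x))" "cube_adjacent (Suc (2 * x)) (2 * x)"
proof -
  have "bit (2 * x) j \<noteq> bit (Suc (2 * x)) j \<longleftrightarrow> j = 0" for j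
    by (auto simp: bit_double bit_double_plus_1)
  then show "cube_adjacent (2 * x) (Suc (2 * x))" "cube_adjacent (Suc (2 * x)) (2 * x)"
    unfolding cube_adjacent_def by metis+
qed

lemma parity_partition:
  fixes A :: "nat set"
  shows "A = (\<lambda>x. 2 * x) ` {x. 2 * x \<in> A} \<union> (\<lambda>x. Suc (2 * x)) ` {x. Suc (2 * x) \<in> A}"
proof -
  have "x = 2 * (x div 2) \<or> x = Suc (2 * (x div 2))" for x :: nat
    by presburger
  then show ?thesis
    by (force simp: image_iff)
qed

lemma card_parity_partition:
  fixes A :: "nat set"
  assumes "finite A"
  shows "card A = card {x. 2 * x \<in> A} + card {x. Suc (2 * x) \<in> A}"
proof -
  let ?e = "\<lambda>x::nat. 2 * x" and ?o = "\<lambda>x::nat. Suc (2 * x)"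
  let ?A0 = "?e -` A" and ?A1 = "?o -` A"
  have fin: "finite ?A0" "finite ?A1"
    using assms by (auto intro: finite_vimageI simp: inj_def)
  have "card A = card (?e ` ?A0 \<union> ?o ` ?A1)"
    using parity_partition[of A] by (simp add: vimage_def)
  also have "\<dots> = card (?e ` ?A0) + card (?o ` ?A1)"
  proof (intro card_Un_disjoint)
    show "?e ` ?A0 \<inter> ?o ` ?A1 = {}"
      by (auto; presburger)
  qed (use fin in \<open>blast intro: finite_imageI\<close>)+
  also have "\<dots> = card ?A0 + card ?A1"
    using card_image[of ?e ?A0] card_image[of ?o ?A1] by (simp add: inj_on_def del: image_vimage_eq)
  finally show ?thesis by (simp add: vimage_def)
qed

text \<open>
  The case distinction behind the gluing of two expanding graphs, with \<open>n0\<close> and \<open>n1\<close> nodes, along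
  a matching that covers the smaller one: \<open>ti\<close> counts the chosen nodes in part \<open>i\<close>, \<open>ci\<close> the cut
  edges inside part \<open>i\<close>, and \<open>vi\<close> the matching edges that leave the set from part \<open>i\<close>. If both
  parts are chosen at most by half, or both at least by half, the cuts inside the parts suffice.
  If one is chosen by more than half and the other by less, the matching edges make up for the
  difference. This can fail if the sizes of the parts differ by more than one.
\<close>

lemma matched_halves_arith:
  fixes t0 t1 n0 n1 c0 c1 v0 v1 :: nat
  assumes "t0 \<le> n0" "t1 \<le> n1" "n1 \<le> n0" "n0 \<le> Suc n1"
    and "min t0 (n0 - t0) \<le> c0" "min t1 (n1 - t1) \<le> c1"
    and "t0 \<le> v0 + t1 + (n0 - n1)" "t1 \<le> v1 + t0"
  shows "min (t0 + t1) (n0 + n1 - (t0 + t1)) \<le> c0 + c1 + v0 + v1"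
  using assms by linarith

text \<open>
  The even and the odd numbers below \<open>n\<close> are copies of initial segments of sizes \<open>\<lceil>n/2\<rceil>\<close> and
  \<open>\<lfloor>n/2\<rfloor>\<close>, and flipping the lowest bit matches all odd numbers with even ones.
\<close>

lemma cube_expanding_initial: "expanding cube_adjacent {..<n}"
proof (induction n rule: less_induct)
  case (less n)
  show ?case
  proof (cases "n \<le> 1")
    case True
    have "min (card T) (n - card T) = 0" if "T \<subseteq> {..<n}" for T
      using card_mono[OF _ that] True by simp
    then show ?thesis
      by (simp add: expanding_def)
  next
    case False
    define n0 n1 where "n0 = (n + 1) div 2" and "n1 = n div 2"
    have n01: "n0 < n" "n1 < n" "n = n0 + n1" "n1 \<le> n0" "n0 \<le> Suc n1"
      using False unfolding n0_def n1_def by presburger+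
    have even_less: "2 * x < n \<longleftrightarrow> x < n0" and odd_less: "Suc (2 * x) < n \<longleftrightarrow> x < n1" for x
      unfolding n0_def n1_def by presburger+
    show ?thesis
      unfolding expanding_def card_lessThan
    proof (intro allI impI)
      fix T assume T: "T \<subseteq> {..<n}"
      define T0 T1 where "T0 = {x. 2 * x \<in> T}" and "T1 = {x. Suc (2 * x) \<in> T}"
      have T0: "T0 \<subseteq> {..<n0}" and T1: "T1 \<subseteq> {..<n1}"
        using T even_less odd_less by (auto simp: T0_def T1_def)
      have fin: "finite T" "finite T0" "finite T1"
        using T T0 T1 finite_subset by blast+
      let ?c0 = "cut_pairs cube_adjacent {..<n0} T0" and ?c1 = "cut_pairs cube_adjacent {..<n1} T1"
      let ?v0 = "T0 \<inter> {..<n1} - T1" and ?v1 = "T1 - T0"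
      let ?A = "(\<lambda>(u, v). (2 * u, 2 * v)) ` ?c0" and ?B = "(\<lambda>(u, v). (Suc (2 * u), Suc (2 * v))) ` ?c1"
        and ?C = "(\<lambda>u. (2 * u, Suc (2 * u))) ` ?v0" and ?D = "(\<lambda>u. (Suc (2 * u), 2 * u)) ` ?v1"
      \<comment> \<open>Cut edges inside the two halves, and matching edges in both directions.\<close>
      have sub: "?A \<union> ?B \<union> ?C \<union> ?D \<subseteq> cut_pairs cube_adjacent {..<n} T"
        using T1 n01 even_less odd_less cube_adjacent_double cube_adjacent_vertical
        by (auto simp: cut_pairs_def T0_def T1_def)
      have finc: "finite ?c0" "finite ?c1"
        using T0 T1 finite_cut_pairs by blast+
      have "card (?A \<union> ?B \<union> ?C \<union> ?D) = card ?A + card ?B + card ?C + card ?D"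
      proof -
        have "?A \<inter> ?B = {}" "(?A \<union> ?B) \<inter> ?C = {}" "(?A \<union> ?B \<union> ?C) \<inter> ?D = {}"
          by (auto; presburger)+
        then show ?thesis
          using finc fin by (simp add: card_Un_disjoint)
      qed
      also have "\<dots> = card ?c0 + card ?c1 + card ?v0 + card ?v1"
        by (simp add: card_image inj_on_def split_beta prod_eq_iff)
      finally have cards: "card ?c0 + card ?c1 + card ?v0 + card ?v1 \<le> card (cut_pairs cube_adjacent {..<n} T)"
        using card_mono[OF finite_cut_pairs sub] T by simp
      have "card T0 \<le> card (?v0 \<union> T1 \<union> {n1..<n0})"
        using T0 fin by (intro card_mono) auto
      also have "\<dots> \<le> card ?v0 + card T1 + card {n1..<n0}"
        by (meson add_right_mono card_Un_le le_trans)
      finally have v0: "card T0 \<le> card ?v0 + card T1 + (n0 - n1)"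
        by simp
      have "card T1 \<le> card (?v1 \<union> T0)"
        using fin by (intro card_mono) auto
      also have "\<dots> \<le> card ?v1 + card T0"
        by (rule card_Un_le)
      finally have v1: "card T1 \<le> card ?v1 + card T0" .
      have c0: "min (card T0) (n0 - card T0) \<le> card ?c0"
        using less.IH[of n0] n01 T0 by (auto simp: expanding_def)
      have c1: "min (card T1) (n1 - card T1) \<le> card ?c1"
        using less.IH[of n1] n01 T1 by (auto simp: expanding_def)
      have t: "card T0 \<le> n0" "card T1 \<le> n1"
        using card_mono[OF _ T0] card_mono[OF _ T1] by auto
      have "card T = card T0 + card T1"
        using card_parity_partition[OF fin(1)] by (simp add: T0_def T1_def)
      then have "min (card T) (n - card T) \<le> card ?c0 + card ?c1 + card ?v0 + card ?v1"
        using matched_halves_arith[OF t n01(4,5) c0 c1 v0 v1] n01(3) by simp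
      then show "min (card T) (n - card T) \<le> card (cut_pairs cube_adjacent {..<n} T)"
        using cards by linarith
    qed
  qed
qed

section \<open>Pairs with a unique sum\<close>

definition bit_sum :: "nat \<Rightarrow> nat \<Rightarrow> nat \<Rightarrow> nat" where
  "bit_sum x y i = of_bool (bit x i) + of_bool (bit y i)"

text \<open>
  If two different pairs of vertices have the same sum, the two segments share their midpoint, so that
  neither of them is an edge. So there are at most as many edges as pairs with a unique sum.
\<close>

definition unique_sum_pairs :: "nat set \<Rightarrow> (nat \<times> nat) set" where
  "unique_sum_pairs S = {(x, y). x \<in> S \<and> y \<in> S \<and> x < y \<and>
     (\<forall>u\<in>S. \<forall>v\<in>S. bit_sum u v = bit_sum x y \<longrightarrow> u = x \<and> v = y \<or> u = y \<and> v = x)}"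

lemma finite_unique_sum_pairs: "finite S \<Longrightarrow> finite (unique_sum_pairs S)"
  by (rule finite_subset[of _ "S \<times> S"]) (auto simp: unique_sum_pairs_def)

lemma unique_sum_pairsI:
  assumes "x \<in> S" "y \<in> S" "x < y"
    and "\<And>u v. u \<in> S \<Longrightarrow> v \<in> S \<Longrightarrow> bit_sum u v = bit_sum x y \<Longrightarrow> u = x \<and> v = y \<or> u = y \<and> v = x"
  shows "(x, y) \<in> unique_sum_pairs S"
  unfolding unique_sum_pairs_def mem_Collect_eq case_prod_conv using assms by (intro conjI ballI impI)

lemma unique_sum_pairsD:
  assumes "(x, y) \<in> unique_sum_pairs S"
  shows "x \<in> S" "y \<in> S" "x < y"
    and "\<And>u v. u \<in> S \<Longrightarrow> v \<in> S \<Longrightarrow> bit_sum u v = bit_sum x y \<Longrightarrow> u = x \<and> v = y \<or> u = y \<and> v = x"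
  using assms by (simp_all add: unique_sum_pairs_def)

lemma bit_sum_double:
  assumes "bit_sum u v = bit_sum x y"
  shows "bit_sum (2 * u) (2 * v) = bit_sum (2 * x) (2 * y)"
    and "bit_sum (Suc (2 * u)) (Suc (2 * v)) = bit_sum (Suc (2 * x)) (Suc (2 * y))"
proof -
  have "bit_sum u v i = bit_sum x y i" for i
    using assms by simp
  then have "bit_sum (2 * u) (2 * v) i = bit_sum (2 * x) (2 * y) i"
    and "bit_sum (Suc (2 * u)) (Suc (2 * v)) i = bit_sum (Suc (2 * x)) (Suc (2 * y)) i" for i
    by (cases i; simp add: bit_sum_def bit_double bit_double_plus_1)+
  then show "bit_sum (2 * u) (2 * v) = bit_sum (2 * x) (2 * y)"
    and "bit_sum (Suc (2 * u)) (Suc (2 * v)) = bit_sum (Suc (2 * x)) (Suc (2 * y))"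
    by blast+
qed

lemma bit_sum_swap: "bit_sum (Suc (2 * x)) (2 * y) = bit_sum (2 * x) (Suc (2 * y))"
  by (auto simp: bit_sum_def fun_eq_iff bit_double bit_double_plus_1)

lemma bit_sum_commute: "bit_sum x y = bit_sum y x"
  by (simp add: bit_sum_def fun_eq_iff)

text \<open>
  An even and an odd number can exchange their lowest bits without changing the sum of their bit
  patterns.
\<close>

lemma unique_sum_pair_mixed:
  assumes "Suc (2 * p) \<in> S" "2 * q \<in> S" "{2 * p, Suc (2 * q)} = {x, y}" "(x, y) \<in> unique_sum_pairs S"
  shows "p = q"
proof -
  have "bit_sum (Suc (2 * p)) (2 * q) = bit_sum x y"
    using assms(3) bit_sum_swap[of p q] by (auto simp: doubleton_eq_iff bit_sum_commute)
  then have "Suc (2 * p) = x \<or> Suc (2 * p) = y"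
    using unique_sum_pairsD(4)[OF assms(4,1,2)] by blast
  then show ?thesis
    using assms(3) by (auto simp: doubleton_eq_iff)
qed

text \<open>
  Split the numbers by parity again. Pairs of equal parity are pairs with a unique sum in one of
  the two halves, of sizes \<open>\<lceil>n/2\<rceil>\<close> and \<open>\<lfloor>n/2\<rfloor>\<close>. For a pair of different parity, the exchange of
  the lowest bits must be trivial or leave \<open>{..<n}\<close>. The first possibility gives the at most
  \<open>n/2\<close> pairs \<open>{2p, 2p + 1}\<close>; the second one forces the even number to be the largest number
  \<open>n - 1\<close>, and there are at most \<open>n/2\<close> odd partners. So each bit contributes at most \<open>n\<close> pairs.
\<close>

lemma card_unique_sum_pairs_initial:
  "n \<le> 2 ^ d \<Longrightarrow> card (unique_sum_pairs {..<n}) \<le> d * n"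
proof (induction d arbitrary: n)
  case 0
  then have "unique_sum_pairs {..<n} = {}"
    by (auto simp: unique_sum_pairs_def)
  then show ?case by simp
next
  case (Suc d)
  define n0 n1 where "n0 = (n + 1) div 2" and "n1 = n div 2"
  have n01: "n0 \<le> 2 ^ d" "n1 \<le> 2 ^ d" "n = n0 + n1" "2 * n1 \<le> n"
    using Suc.prems unfolding n0_def n1_def by auto
  have even_less: "2 * x < n \<longleftrightarrow> x < n0" and odd_less: "Suc (2 * x) < n \<longleftrightarrow> x < n1" for x
    unfolding n0_def n1_def by presburger+
  \<comment> \<open>The fourth set covers the pairs whose exchange of lowest bits leaves \<open>{..<n}\<close>.\<close>
  let ?A = "(\<lambda>(u, v). (2 * u, 2 * v)) ` unique_sum_pairs {..<n0}"
    and ?B = "(\<lambda>(u, v). (Suc (2 * u), Suc (2 * v))) ` unique_sum_pairs {..<n1}"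
    and ?C = "(\<lambda>u. (2 * u, Suc (2 * u))) ` {..<n1}"
    and ?D = "(\<lambda>u. (Suc (2 * u), n - 1)) ` {..<n1}"
  have "unique_sum_pairs {..<n} \<subseteq> ?A \<union> ?B \<union> ?C \<union> ?D"
  proof
    fix z assume z: "z \<in> unique_sum_pairs {..<n}"
    obtain x y where zxy: "z = (x, y)" by (cases z)
    note xy_unique = unique_sum_pairsD[OF z[unfolded zxy]]
    have xy: "x < n" "y < n" "x < y"
      using xy_unique(1-3) by simp_all
    have uniq: "u = x \<and> v = y \<or> u = y \<and> v = x"
      if "u < n" "v < n" "bit_sum u v = bit_sum x y" for u v
      using that by (intro xy_unique(4)) simp_all
    define p q where "p = x div 2" and "q = y div 2"
    have ee: "z \<in> ?A" if ee: "x = 2 * p" "y = 2 * q"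
    proof -
      have "(p, q) \<in> unique_sum_pairs {..<n0}"
      proof (rule unique_sum_pairsI)
        fix u v assume *: "u \<in> {..<n0}" "v \<in> {..<n0}" "bit_sum u v = bit_sum p q"
        have "2 * u = x \<and> 2 * v = y \<or> 2 * u = y \<and> 2 * v = x"
          using * bit_sum_double(1)[OF *(3)] by (intro uniq) (simp_all add: ee even_less)
        then show "u = p \<and> v = q \<or> u = q \<and> v = p"
          unfolding ee by simp
      qed (use ee xy even_less in auto)
      then show ?thesis
        unfolding zxy ee by (rule image_eqI[rotated]) simp
    qed
    have oo: "z \<in> ?B" if oo: "x = Suc (2 * p)" "y = Suc (2 * q)"
    proof -
      have "(p, q) \<in> unique_sum_pairs {..<n1}"
      proof (rule unique_sum_pairsI)
        fix u v assume *: "u \<in> {..<n1}" "v \<in> {..<n1}" "bit_sum u v = bit_sum p q"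
        have "Suc (2 * u) = x \<and> Suc (2 * v) = y \<or> Suc (2 * u) = y \<and> Suc (2 * v) = x"
          using * bit_sum_double(2)[OF *(3)] by (intro uniq) (simp_all add: oo odd_less)
        then show "u = p \<and> v = q \<or> u = q \<and> v = p"
          unfolding oo by simp
      qed (use oo xy odd_less in auto)
      then show ?thesis
        unfolding zxy oo by (rule image_eqI[rotated]) simp
    qed
    have eo: "z \<in> ?C" if eo: "x = 2 * p" "y = Suc (2 * q)"
    proof -
      have "p = q"
        using z xy unfolding zxy eo by (intro unique_sum_pair_mixed[of p "{..<n}" q x y]) (simp_all add: eo)
      then show ?thesis
        using xy odd_less[of q] unfolding zxy eo by simp
    qed
    have oe: "z \<in> ?D" if oe: "x = Suc (2 * p)" "y = 2 * q"
    proof -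
      have "y = n - 1"
      proof (rule ccontr)
        assume "y \<noteq> n - 1"
        then have "q = p"
          using z xy unfolding zxy oe
          by (intro unique_sum_pair_mixed[of q "{..<n}" p x y]) (simp_all add: oe insert_commute)
        then show False using oe xy by simp
      qed
      then show ?thesis
        using xy odd_less[of p] unfolding zxy oe(1) by simp
    qed
    have "x = 2 * p \<or> x = Suc (2 * p)" "y = 2 * q \<or> y = Suc (2 * q)"
      unfolding p_def q_def by presburger+
    with ee oo eo oe show "z \<in> ?A \<union> ?B \<union> ?C \<union> ?D"
      unfolding Un_iff by argo
  qed
  then have "card (unique_sum_pairs {..<n}) \<le> card (?A \<union> ?B \<union> ?C \<union> ?D)"
    by (rule card_mono[rotated]) (simp add: finite_unique_sum_pairs)
  also have "\<dots> \<le> card ?A + card ?B + card ?C + card ?D"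
    by (meson add_right_mono card_Un_le le_trans)
  also have "\<dots> \<le> card (unique_sum_pairs {..<n0}) + card (unique_sum_pairs {..<n1}) + n1 + n1"
  proof (intro add_mono)
    show "card ?A \<le> card (unique_sum_pairs {..<n0})" "card ?B \<le> card (unique_sum_pairs {..<n1})"
      by (auto intro!: card_image_le finite_unique_sum_pairs)
    show "card ?C \<le> n1" "card ?D \<le> n1"
      using card_image_le[of "{..<n1}"] by (metis card_lessThan finite_lessThan)+
  qed
  also have "\<dots> \<le> d * n0 + d * n1 + n"
    using Suc.IH[OF n01(1)] Suc.IH[OF n01(2)] n01(4) by linarith
  also have "\<dots> = Suc d * n"
    by (simp add: n01(3) algebra_simps)
  finally show ?case .
qed

lemma card_unique_sum_pairs_insert:
  assumes "finite S" and "\<And>x. x \<in> S \<Longrightarrow> x < a"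
  shows "card (unique_sum_pairs (insert a S)) \<le> card (unique_sum_pairs S) + card S"
proof -
  have "unique_sum_pairs (insert a S) \<subseteq> unique_sum_pairs S \<union> (\<lambda>x. (x, a)) ` S"
  proof clarify
    fix x y assume "(x, y) \<in> unique_sum_pairs (insert a S)" and new: "(x, y) \<notin> (\<lambda>x. (x, a)) ` S"
    note xy = unique_sum_pairsD[OF this(1)]
    have "x \<noteq> a" and "y \<noteq> a"
      using xy(1-3) new assms(2) by (auto dest: less_asym)
    then show "(x, y) \<in> unique_sum_pairs S"
      using xy by (intro unique_sum_pairsI) auto
  qed
  then have "card (unique_sum_pairs (insert a S)) \<le> card (unique_sum_pairs S \<union> (\<lambda>x. (x, a)) ` S)"
    using assms(1) by (intro card_mono) (auto intro: finite_unique_sum_pairs)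
  also have "\<dots> \<le> card (unique_sum_pairs S) + card ((\<lambda>x. (x, a)) ` S)"
    by (rule card_Un_le)
  also have "\<dots> \<le> card (unique_sum_pairs S) + card S"
    using card_image_le[OF assms(1)] by simp
  finally show ?thesis .
qed

section \<open>Exposed edges\<close>

definition weight :: "nat \<Rightarrow> (nat \<Rightarrow> real) \<Rightarrow> nat \<Rightarrow> real" where
  "weight d c x = (\<Sum>i<d. c i * of_bool (bit x i))"

text \<open>
  A certificate for an edge: a linear functional whose maximum over the points in \<open>S\<close> is attained
  exactly at \<open>x\<close> and \<open>y\<close>.
\<close>

definition exposed_pair :: "nat \<Rightarrow> nat set \<Rightarrow> nat \<Rightarrow> nat \<Rightarrow> bool" where
  "exposed_pair d S x y \<longleftrightarrow>
     (\<exists>c. weight d c x = weight d c y \<and> (\<forall>z\<in>S - {x, y}. weight d c z < weight d c x))"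

text \<open>
  This functional rewards agreement with \<open>x\<close> and ignores the coordinates in \<open>J\<close>. On the cube it is
  maximal exactly on the face through \<open>x\<close> in which the coordinates in \<open>J\<close> are free: on the vertex
  \<open>x\<close> for \<open>J = {}\<close>, and on a cube edge for a singleton.
\<close>

definition agreement_coeff :: "nat set \<Rightarrow> nat \<Rightarrow> nat \<Rightarrow> real" where
  "agreement_coeff J x i = (if i \<in> J then 0 else if bit x i then 1 else -1)"

lemma weight_agreement_coeff:
  shows "(\<And>i. i < d \<Longrightarrow> i \<notin> J \<Longrightarrow> bit x i = bit z i) \<Longrightarrow>
      weight d (agreement_coeff J x) z = weight d (agreement_coeff J x) x"
    and "i < d \<Longrightarrow> i \<notin> J \<Longrightarrow> bit x i \<noteq> bit z i \<Longrightarrow>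
      weight d (agreement_coeff J x) z < weight d (agreement_coeff J x) x"
proof -
  assume "\<And>i. i < d \<Longrightarrow> i \<notin> J \<Longrightarrow> bit x i = bit z i"
  then show "weight d (agreement_coeff J x) z = weight d (agreement_coeff J x) x"
    unfolding weight_def by (intro sum.cong) (auto simp: agreement_coeff_def)
next
  assume "i < d" "i \<notin> J" "bit x i \<noteq> bit z i"
  then show "weight d (agreement_coeff J x) z < weight d (agreement_coeff J x) x"
    unfolding weight_def by (intro sum_strict_mono_ex1) (auto simp: agreement_coeff_def)
qed

lemma weight_exposes_vertex:
  assumes "x < 2 ^ d" "z < 2 ^ d" "z \<noteq> x"
  shows "weight d (agreement_coeff {} x) z < weight d (agreement_coeff {} x) x"
  using assms eq_if_low_bits_eq[of x d z] weight_agreement_coeff(2)[of _ d "{}" x z] by blast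

lemma exposed_pair_if_cube_adjacent:
  assumes S: "S \<subseteq> {..<2 ^ d}" and "x \<in> S" "y \<in> S" and "cube_adjacent x y"
  shows "exposed_pair d S x y"
proof -
  obtain i where i: "\<And>j. bit x j \<noteq> bit y j \<longleftrightarrow> j = i"
    using assms(4) by (auto simp: cube_adjacent_def)
  let ?c = "agreement_coeff {i} x"
  have "weight d ?c z < weight d ?c x" if "z \<in> S" "z \<noteq> x" "z \<noteq> y" for z
  proof -
    have b: "x < 2 ^ d" "y < 2 ^ d" "z < 2 ^ d"
      using assms that by auto
    have "\<exists>j<d. j \<noteq> i \<and> bit x j \<noteq> bit z j"
    proof (rule ccontr)
      assume "\<not> ?thesis"
      then have agree: "bit x j = bit z j" if "j < d" "j \<noteq> i" for j
        using that by blast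
      show False
      proof (cases "bit x i = bit z i")
        case True
        then show False
          using agree eq_if_low_bits_eq[OF b(1,3)] that(2) by metis
      next
        case False
        then have "bit y j = bit z j" if "j < d" for j
          using agree[OF that] i by metis
        then show False
          using eq_if_low_bits_eq[OF b(2,3)] that(3) by metis
      qed
    qed
    then show ?thesis
      using weight_agreement_coeff(2)[of _ d "{i}" x z] by blast
  qed
  moreover have "weight d ?c y = weight d ?c x"
    using i by (intro weight_agreement_coeff(1)) auto
  ultimately show ?thesis
    unfolding exposed_pair_def by (intro exI[of _ ?c]) auto
qed

lemma exposed_pair_commute: "exposed_pair d S x y \<longleftrightarrow> exposed_pair d S y x"
  unfolding exposed_pair_def by (metis insert_commute)

text \<open>
  The apex \<open>2 ^ d\<close> is the only point that uses the coordinate \<open>d\<close>. Starting from a functional that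
  exposes the vertex \<open>x\<close> of the base, the coefficient of this coordinate can therefore be chosen to
  lift the apex to the height of \<open>x\<close>.
\<close>

lemma exposed_pair_apex:
  assumes S: "S \<subseteq> {..<2 ^ d}" and x: "x \<in> S"
  shows "exposed_pair (Suc d) (insert (2 ^ d) S) x (2 ^ d)"
proof -
  let ?c = "agreement_coeff {} x"
  let ?c' = "?c(d := weight d ?c x)"
  have low: "weight (Suc d) ?c' z = weight d ?c z" if "z \<in> S" for z
    using that S not_bit_if_less_power[of z d d] by (auto simp: weight_def)
  have apex: "weight (Suc d) ?c' (2 ^ d) = weight d ?c x"
    by (simp add: weight_def bit_exp_iff)
  show ?thesis
    unfolding exposed_pair_def
    using low apex x S weight_exposes_vertex[of x d] by (intro exI[of _ ?c']) force
qed

section \<open>The vertex set\<close>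

text \<open>
  For more than \<open>2 ^ (d - 1)\<close> vertices, the initial segment \<open>{..<n}\<close> works; it is large enough to
  contain all unit vectors. For fewer vertices, a pyramid over the solution for \<open>d - 1\<close> and
  \<open>n - 1\<close> works. Its apex is adjacent to all other vertices, which already gives the expansion.
  It adds at most \<open>n - 1\<close> pairs with a unique sum to the at most \<open>(d - 1) * (n - 1)\<close> pairs of the base.
\<close>

lemma vertex_code_exists:
  assumes "d + 1 \<le> n" and "n \<le> 2 ^ d"
  shows "\<exists>S \<subseteq> {..<2 ^ d}. card S = n \<and> 0 \<in> S \<and> (\<forall>i<d. 2 ^ i \<in> S) \<and>
    card (unique_sum_pairs S) \<le> d * n \<and> expanding (exposed_pair d S) S"
  using assms
proof (induction d arbitrary: n)
  case 0
  then have "n = 1" by simp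
  have "expanding (exposed_pair 0 {..<1}) {..<1}"
    using expanding_mono[OF cube_expanding_initial[of 1]] exposed_pair_if_cube_adjacent[of "{..<1}" 0]
    by simp
  moreover have "card (unique_sum_pairs {..<1}) \<le> 0"
    using card_unique_sum_pairs_initial[of 1 0] by simp
  ultimately show ?case
    using \<open>n = 1\<close> by (intro exI[of _ "{..<1}"]) simp
next
  case (Suc d)
  show ?case
  proof (cases "2 ^ d < n")
    case True
    have sub: "{..<n} \<subseteq> {..<2 ^ Suc d}"
      using Suc.prems by auto
    have "2 ^ i < n" if "i < Suc d" for i
    proof -
      have "(2::nat) ^ i \<le> 2 ^ d"
        using that by (intro power_increasing) simp_all
      then show ?thesis
        using True by (rule le_less_trans)
    qed
    moreover have "expanding (exposed_pair (Suc d) {..<n}) {..<n}"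
      using expanding_mono[OF cube_expanding_initial] exposed_pair_if_cube_adjacent[OF sub] by simp
    ultimately show ?thesis
      using card_unique_sum_pairs_initial[of n "Suc d"] Suc.prems sub
      by (intro exI[of _ "{..<n}"]) auto
  next
    case False
    then have "d + 1 \<le> n - 1" "n - 1 \<le> 2 ^ d"
      using Suc.prems by linarith+
    then obtain S where S: "S \<subseteq> {..<2 ^ d}" "card S = n - 1" "0 \<in> S" "\<forall>i<d. 2 ^ i \<in> S"
      "card (unique_sum_pairs S) \<le> d * (n - 1)"
      using Suc.IH[of "n - 1"] by blast
    let ?S = "insert (2 ^ d) S"
    have fin: "finite S" and notin: "2 ^ d \<notin> S"
      using S(1) finite_subset by auto
    have "card (unique_sum_pairs ?S) \<le> card (unique_sum_pairs S) + card S"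
      using S(1) by (intro card_unique_sum_pairs_insert fin) auto
    also have "\<dots> \<le> Suc d * (n - 1)"
      using S(2,5) by simp
    also have "\<dots> \<le> Suc d * n"
      by (rule mult_le_mono2) simp
    finally have "card (unique_sum_pairs ?S) \<le> Suc d * n" .
    moreover have "expanding (exposed_pair (Suc d) ?S) ?S"
      using exposed_pair_apex[OF S(1)] exposed_pair_commute by (intro expanding_apex fin notin) blast+
    moreover have "?S \<subseteq> {..<2 ^ Suc d}"
      using S(1) by auto
    moreover have "card ?S = n"
      using fin notin S(2) Suc.prems by simp
    moreover have "\<forall>i<Suc d. 2 ^ i \<in> ?S"
      using S(4) less_Suc_eq by auto
    ultimately show ?thesis
      using S(3) by (intro exI[of _ ?S]) auto
  qed
qed

section \<open>Faces of a convex hull\<close>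

text \<open>
  Instead of a decomposition into vertices, the proof exhibits a convex set that contains \<open>S\<close>: the
  points of the hull that lie outside \<open>F\<close> or in the hull of \<open>F \<inter> S\<close>. A point of \<open>F\<close> inside a segment
  forces both end points into \<open>F\<close>, which makes this set convex in every real vector space.
\<close>

lemma face_of_convex_hull_eq_hull_Int:
  fixes S :: "'a::real_vector set"
  assumes "F face_of convex hull S"
  shows "F = convex hull (F \<inter> S)"
proof -
  let ?Q = "{p \<in> convex hull S. p \<in> F \<longrightarrow> p \<in> convex hull (F \<inter> S)}"
  have "convex ?Q"
  proof (intro convex_contains_open_segment[THEN iffD2] ballI subsetI)
    fix a b p assume a: "a \<in> ?Q" and b: "b \<in> ?Q" and p: "p \<in> open_segment a b"
    have "p \<in> convex hull S"
      using a b p convex_contains_open_segment[of "convex hull S"] by auto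
    moreover have "p \<in> convex hull (F \<inter> S)" if "p \<in> F"
    proof -
      have "a \<in> F" "b \<in> F"
        using face_ofD[OF assms p] a b that by auto
      then show ?thesis
        using a b p convex_contains_open_segment[of "convex hull (F \<inter> S)"] by auto
    qed
    ultimately show "p \<in> ?Q" by simp
  qed
  moreover have "S \<subseteq> ?Q"
    by (auto intro: hull_inc)
  ultimately have "convex hull S \<subseteq> ?Q"
    by (rule hull_minimal[rotated])
  then have "F \<subseteq> convex hull (F \<inter> S)"
    using face_of_imp_subset[OF assms] by blast
  moreover have "convex hull (F \<inter> S) \<subseteq> F"
    using face_of_imp_convex[OF assms] by (intro hull_minimal) auto
  ultimately show ?thesis by blast
qed

text \<open>
  The open half-space below the maximum \<open>M\<close>, together with the hull of the maximizers, is convex and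
  contains \<open>S\<close>; so no further point of the hull reaches \<open>M\<close>.
\<close>

lemma supporting_face_of_convex_hull:
  fixes f :: "'a::real_vector \<Rightarrow> real"
  assumes f: "linear f" and le: "\<And>p. p \<in> S \<Longrightarrow> f p \<le> M"
  shows "convex hull (S \<inter> {p. f p = M}) face_of convex hull S"
proof -
  let ?C = "convex hull (S \<inter> {p. f p = M})"
  have lin: "f (u *\<^sub>R a + v *\<^sub>R b) = u * f a + v * f b" for u v a b
    using f by (simp add: linear_add linear_scale)
  have C_eq: "?C \<subseteq> {p. f p = M}"
  proof (rule hull_minimal)
    show "convex {p. f p = M}"
      by (auto simp: convex_def lin simp flip: distrib_right)
  qed auto
  let ?Q = "{p. f p < M} \<union> ?C"
  have strict: "u * a + v * b < M" 
    if "a < M" "b \<le> M" "0 < u" "0 \<le> v" "u + v = 1" for u v a b :: real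
  proof -
    have "u * a < u * M" "v * b \<le> v * M"
      using that by (auto intro: mult_left_mono)
    then have "u * a + v * b < (u + v) * M"
      by (simp add: distrib_right)
    then show ?thesis using that by simp
  qed
  have le_M: "f p \<le> M" if "p \<in> ?Q" for p
    using that C_eq by auto
  have comb_less: "f ((1 - t) *\<^sub>R a + t *\<^sub>R b) < M"
    if "a \<in> ?Q" "b \<in> ?Q" "a \<notin> ?C \<or> b \<notin> ?C" "0 < t" "t < 1" for a b t
    using that strict[of "f a" "f b" "1 - t" t] strict[of "f b" "f a" t "1 - t"] le_M[of a] le_M[of b]
    by (auto simp: lin add.commute)
  have "convex ?Q"
  proof (intro convex_contains_open_segment[THEN iffD2] ballI subsetI)
    fix a b p assume a: "a \<in> ?Q" and b: "b \<in> ?Q" and p: "p \<in> open_segment a b"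
    show "p \<in> ?Q"
    proof (cases "a \<in> ?C \<and> b \<in> ?C")
      case True
      then show ?thesis
        using p convex_contains_open_segment[of ?C] by auto
    next
      case False
      then show ?thesis
        using p comb_less[OF a b] by (auto simp: in_segment)
    qed
  qed
  moreover have "S \<subseteq> ?Q"
    using le by (force intro: hull_inc)
  ultimately have hull: "convex hull S \<subseteq> ?Q"
    by (rule hull_minimal[rotated])
  show ?thesis
    unfolding face_of_def
  proof (intro conjI ballI impI)
    show "?C \<subseteq> convex hull S"
      by (rule hull_mono) simp
  next
    fix a b p
    assume ab: "a \<in> convex hull S" "b \<in> convex hull S" and p: "p \<in> ?C" "p \<in> open_segment a b"
    have "f p = M"
      using p C_eq by auto
    then have "\<not> (a \<notin> ?C \<or> b \<notin> ?C)"
      using comb_less[of a b] p(2) hull ab by (auto simp: in_segment)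
    then show "a \<in> ?C" "b \<in> ?C"
      by auto
  qed simp
qed

section \<open>Points with 0/1 coordinates\<close>

lemma lookup_scaleR:
  "Poly_Mapping.lookup (r *\<^sub>R x) i = r *\<^sub>R Poly_Mapping.lookup x i"
proof -
  have "finite {i. r *\<^sub>R Poly_Mapping.lookup x i \<noteq> 0}"
    by (rule finite_subset[OF _ finite_lookup[of x]]) auto
  then show ?thesis
    by (simp add: scaleR_poly_mapping_def)
qed

definition unit_vector :: "nat \<Rightarrow> (nat \<Rightarrow>\<^sub>0 real)" where
  "unit_vector i = Poly_Mapping.single i 1"

definition bit_vector :: "nat \<Rightarrow> nat \<Rightarrow> (nat \<Rightarrow>\<^sub>0 real)" where
  "bit_vector d x = (\<Sum>i<d. of_bool (bit x i) *\<^sub>R unit_vector i)"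

lemma lookup_unit_vector: "Poly_Mapping.lookup (unit_vector i) j = of_bool (i = j)"
  by (simp add: unit_vector_def lookup_single when_def)

lemma lookup_bit_vector:
  "Poly_Mapping.lookup (bit_vector d x) i = of_bool (i < d \<and> bit x i)"
proof -
  have "Poly_Mapping.lookup (bit_vector d x) i = (\<Sum>j<d. if j = i then of_bool (bit x j) else 0)"
    unfolding bit_vector_def by (auto simp: lookup_sum lookup_scaleR lookup_unit_vector intro: sum.cong)
  then show ?thesis
    by simp
qed

lemma bit_vector_eq_iff:
  assumes "x < 2 ^ d" "y < 2 ^ d"
  shows "bit_vector d x = bit_vector d y \<longleftrightarrow> x = y"
proof
  assume eq: "bit_vector d x = bit_vector d y"
  have "bit x i = bit y i" if "i < d" for i
    using arg_cong[OF eq, of "\<lambda>p. Poly_Mapping.lookup p i"] that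
    by (simp add: lookup_bit_vector of_bool_def split: if_splits)
  then show "x = y"
    using eq_if_low_bits_eq assms by blast
qed simp

definition coord_functional :: "nat \<Rightarrow> (nat \<Rightarrow> real) \<Rightarrow> (nat \<Rightarrow>\<^sub>0 real) \<Rightarrow> real" where
  "coord_functional d c p = (\<Sum>i<d. c i * Poly_Mapping.lookup p i)"

lemma linear_coord_functional: "linear (coord_functional d c)"
  by (rule linearI)
    (simp_all add: coord_functional_def lookup_add lookup_scaleR distrib_left sum.distrib
      sum_distrib_left mult.left_commute)

lemma coord_functional_bit_vector: "coord_functional d c (bit_vector d x) = weight d c x"
  unfolding coord_functional_def weight_def by (intro sum.cong) (auto simp: lookup_bit_vector)

section \<open>The polytope spanned by a set of bit patterns\<close>

lemma dim_1_collinear: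
  assumes "affine_dimension F = 1"
  shows "\<exists>x\<in>F. \<exists>y\<in>F. x \<noteq> y"
    and "x \<in> F \<Longrightarrow> y \<in> F \<Longrightarrow> z \<in> F \<Longrightarrow> x \<noteq> y \<Longrightarrow> \<exists>t. z - y = t *\<^sub>R (x - y)"
proof -
  let ?D = "{x - y |x y. x \<in> F \<and> y \<in> F}"
  have dim: "dim ?D = 1"
    using assms by (auto simp: affine_dimension_def split: if_splits)
  obtain B where B: "B \<subseteq> ?D" "independent B" "?D \<subseteq> span B" "card B = dim ?D"
    using basis_exists by blast
  then obtain b where b: "B = {b}"
    using dim card_1_singletonE by metis
  have "b \<noteq> 0"
    using B(2) b dependent_zero by auto
  moreover have "b \<in> ?D"
    using B(1) b by simp
  ultimately show "\<exists>x\<in>F. \<exists>y\<in>F. x \<noteq> y"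
    by fastforce
  assume xyz: "x \<in> F" "y \<in> F" "z \<in> F" "x \<noteq> y"
  have span: "\<exists>k. p - q = k *\<^sub>R b" if "p \<in> F" "q \<in> F" for p q
    using B(3) that unfolding b by (force simp: span_singleton)
  obtain k l where k: "x - y = k *\<^sub>R b" and l: "z - y = l *\<^sub>R b"
    using span xyz by meson
  have "k \<noteq> 0"
    using k xyz(4) by auto
  then have "z - y = (l / k) *\<^sub>R (x - y)"
    using k l by simp
  then show "\<exists>t. z - y = t *\<^sub>R (x - y)" ..
qed

text \<open>
  At a coordinate where \<open>x\<close> and \<open>y\<close> differ, a point of the line through \<open>x\<close> and \<open>y\<close> has a 0/1
  entry only at the parameters of \<open>x\<close> and \<open>y\<close>. So a one-dimensional face contains no more than two
  0/1-points.
\<close>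

lemma bit_vectors_not_collinear:
  assumes "bit_vector d z - bit_vector d y = t *\<^sub>R (bit_vector d x - bit_vector d y)"
    and "x < 2 ^ d" "y < 2 ^ d" "z < 2 ^ d" and "x \<noteq> y"
  shows "z = x \<or> z = y"
proof -
  have coord: "of_bool (bit z i) - of_bool (bit y i) = t * (of_bool (bit x i) - of_bool (bit y i))"
    if "i < d" for i
    using arg_cong[OF assms(1), of "\<lambda>p. Poly_Mapping.lookup p i"] that
    by (simp add: lookup_minus lookup_scaleR lookup_bit_vector)
  obtain i where "i < d" "bit x i \<noteq> bit y i"
    using eq_if_low_bits_eq assms by blast
  then have "t = 0 \<or> t = 1"
    using coord[of i] by (auto simp: of_bool_def split: if_splits)
  then show ?thesis
  proof
    assume "t = 0"
    then have "bit z i = bit y i" if "i < d" for i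
      using coord[OF that] by (auto simp: of_bool_def split: if_splits)
    then show ?thesis
      using eq_if_low_bits_eq assms by blast
  next
    assume "t = 1"
    then have "bit z i = bit x i" if "i < d" for i
      using coord[OF that] by (auto simp: of_bool_def split: if_splits)
    then show ?thesis
      using eq_if_low_bits_eq assms by blast
  qed
qed

lemma bit_vector_add_eq_if_bit_sum_eq:
  assumes "bit_sum u v = bit_sum x y"
  shows "bit_vector d u + bit_vector d v = bit_vector d x + bit_vector d y"
proof (rule poly_mapping_eqI)
  fix i
  have "bit_sum u v i = bit_sum x y i"
    using assms by simp
  then show "Poly_Mapping.lookup (bit_vector d u + bit_vector d v) i =
      Poly_Mapping.lookup (bit_vector d x + bit_vector d y) i"
    by (auto simp: lookup_add lookup_bit_vector bit_sum_def of_bool_def split: if_splits)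
qed

definition bit_polytope :: "nat \<Rightarrow> nat set \<Rightarrow> (nat \<Rightarrow>\<^sub>0 real) set" where
  "bit_polytope d S = convex hull (bit_vector d ` S)"

lemma zero_one_bit_polytope: "zero_one_polytope (bit_polytope d S)"
proof -
  have "bit_vector d ` S \<subseteq> zero_one_points d"
    by (auto simp: zero_one_points_def lookup_bit_vector)
  then show ?thesis
    unfolding zero_one_polytope_def bit_polytope_def by blast
qed

lemma independent_unit_vectors: "independent (unit_vector ` I)"
  unfolding dependent_def
proof clarify
  fix i assume "i \<in> I" and "unit_vector i \<in> span (unit_vector ` I - {unit_vector i})"
  let ?H = "{p. Poly_Mapping.lookup p i = (0::real)}"
  have "subspace ?H"
    by (auto simp: subspace_def lookup_add lookup_scaleR)
  moreover have "unit_vector ` I - {unit_vector i} \<subseteq> ?H"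
    by (auto simp: lookup_unit_vector)
  ultimately have "span (unit_vector ` I - {unit_vector i}) \<subseteq> ?H"
    by (rule span_minimal[rotated])
  then have "unit_vector i \<in> ?H"
    using \<open>unit_vector i \<in> span _\<close> by blast
  then show False
    by (simp add: lookup_unit_vector)
qed

lemma affine_dimension_bit_polytope:
  assumes "0 \<in> S" and "\<And>i. i < d \<Longrightarrow> 2 ^ i \<in> S"
  shows "affine_dimension (bit_polytope d S) = int d"
proof -
  let ?P = "bit_polytope d S" and ?E = "unit_vector ` {..<d}"
  have inc: "bit_vector d x \<in> ?P" if "x \<in> S" for x
    using that by (simp add: bit_polytope_def hull_inc)
  have zero: "bit_vector d 0 = 0"
    by (simp add: bit_vector_def)
  have unit: "bit_vector d (2 ^ i) = unit_vector i" if "i < d" for i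
    using that by (intro poly_mapping_eqI) (auto simp: lookup_bit_vector lookup_unit_vector bit_exp_iff)
  have "?E \<subseteq> {p - q |p q. p \<in> ?P \<and> q \<in> ?P}"
  proof clarify
    fix i assume "i < d"
    then have "unit_vector i \<in> ?P" "0 \<in> ?P"
      using inc[of "2 ^ i"] inc[of 0] assms by (auto simp: unit zero)
    then show "\<exists>p q. unit_vector i = p - q \<and> p \<in> ?P \<and> q \<in> ?P"
      by (metis diff_zero)
  qed
  moreover have "{p - q |p q. p \<in> ?P \<and> q \<in> ?P} \<subseteq> span ?E"
  proof -
    have "bit_vector d x \<in> span ?E" for x
      unfolding bit_vector_def by (intro span_sum span_scale span_base) auto
    then have "?P \<subseteq> span ?E"
      unfolding bit_polytope_def by (intro hull_minimal subspace_imp_convex subspace_span) auto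
    then show ?thesis
      by (auto intro: span_diff)
  qed
  moreover have "card ?E = d"
  proof -
    have "inj_on unit_vector {..<d}"
      by (rule inj_onI) (metis lookup_unit_vector of_bool_eq_iff)
    then show ?thesis
      by (simp add: card_image)
  qed
  ultimately have "dim {p - q |p q. p \<in> ?P \<and> q \<in> ?P} = d"
    using independent_unit_vectors by (intro dim_unique)
  then show ?thesis
    using inc[OF assms(1)] by (auto simp: affine_dimension_def)
qed

lemma bit_polytope_supporting_face:
  assumes S: "S \<subseteq> {..<2 ^ d}" and A: "A \<subseteq> S"
    and eq: "\<And>x. x \<in> A \<Longrightarrow> weight d c x = M" and less: "\<And>x. x \<in> S - A \<Longrightarrow> weight d c x < M"
  shows "convex hull (bit_vector d ` A) face_of bit_polytope d S"
proof -
  have "bit_vector d ` S \<inter> {p. coord_functional d c p = M} = bit_vector d ` A"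
    using A eq less by (force simp: coord_functional_bit_vector)
  moreover have "coord_functional d c p \<le> M" if "p \<in> bit_vector d ` S" for p
    using that eq less by (force simp: coord_functional_bit_vector)
  ultimately show ?thesis
    unfolding bit_polytope_def
    using supporting_face_of_convex_hull[OF linear_coord_functional] by metis
qed

lemma vertices_bit_polytope:
  assumes "S \<subseteq> {..<2 ^ d}"
  shows "polytope_vertices (bit_polytope d S) = bit_vector d ` S"
proof
  show "polytope_vertices (bit_polytope d S) \<subseteq> bit_vector d ` S"
    unfolding polytope_vertices_def bit_polytope_def by (rule extreme_points_of_convex_hull)
next
  have "bit_vector d x extreme_point_of bit_polytope d S" if "x \<in> S" for x
  proof -
    have "convex hull (bit_vector d ` {x}) face_of bit_polytope d S"
      using assms that
      by (intro bit_polytope_supporting_face[where c = "agreement_coeff {} x"]) (auto intro: weight_exposes_vertex)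
    then show ?thesis
      by (simp add: face_of_singleton)
  qed
  then show "bit_vector d ` S \<subseteq> polytope_vertices (bit_polytope d S)"
    by (auto simp: polytope_vertices_def)
qed

lemma affine_dimension_segment:
  assumes "x \<noteq> y"
  shows "affine_dimension (convex hull {x, y}) = 1"
proof -
  let ?P = "convex hull {x, y}"
  have "{p - q |p q. p \<in> ?P \<and> q \<in> ?P} \<subseteq> span {x - y}"
  proof clarify
    fix p q assume "p \<in> ?P" "q \<in> ?P"
    then obtain s t where "p = (1 - s) *\<^sub>R x + s *\<^sub>R y" "q = (1 - t) *\<^sub>R x + t *\<^sub>R y"
      by (auto simp: in_segment simp flip: segment_convex_hull)
    then have "p - q = (t - s) *\<^sub>R (x - y)"
      by (simp add: scaleR_diff_left scaleR_diff_right)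
    then show "p - q \<in> span {x - y}"
      by (auto simp: span_singleton)
  qed
  moreover have "{x - y} \<subseteq> {p - q |p q. p \<in> ?P \<and> q \<in> ?P}"
    by (auto intro: hull_inc)
  moreover have "independent {x - y}"
    using assms by (simp add: dependent_def)
  ultimately have "dim {p - q |p q. p \<in> ?P \<and> q \<in> ?P} = 1"
    by (intro dim_unique[of "{x - y}"]) auto
  then show ?thesis
    by (simp add: affine_dimension_def)
qed

lemma graph_edge_if_exposed_pair:
  assumes S: "S \<subseteq> {..<2 ^ d}" and xy: "x \<in> S" "y \<in> S" "x \<noteq> y" and "exposed_pair d S x y"
  shows "{bit_vector d x, bit_vector d y} \<in> polytope_graph_edges (bit_polytope d S)"
proof -
  obtain c where c: "weight d c x = weight d c y" "\<And>z. z \<in> S - {x, y} \<Longrightarrow> weight d c z < weight d c x"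
    using assms(5) unfolding exposed_pair_def by blast
  let ?F = "convex hull (bit_vector d ` {x, y})"
  have face: "?F face_of bit_polytope d S"
    using S xy c by (intro bit_polytope_supporting_face[where c = c and M = "weight d c x"]) auto
  have neq: "bit_vector d x \<noteq> bit_vector d y"
    using bit_vector_eq_iff[of x d y] S xy by auto
  then have dim1: "affine_dimension ?F = 1"
    by (simp add: affine_dimension_segment)
  have "polytope_vertices ?F = {bit_vector d x, bit_vector d y}"
    using vertices_bit_polytope[of "{x, y}" d] S xy by (auto simp: bit_polytope_def)
  moreover have "?F \<in> polytope_edges (bit_polytope d S)"
    using face dim1 by (simp add: polytope_edges_def)
  ultimately show ?thesis
    unfolding polytope_graph_edges_def by (metis imageI)
qed

text \<open>
  An edge is the hull of the 0/1-points on it, of which there are exactly two, and the midpoint of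
  an edge lies on no other segment between points of \<open>S\<close>.
\<close>

lemma edge_bit_polytope:
  assumes S: "S \<subseteq> {..<2 ^ d}" and F: "F \<in> polytope_edges (bit_polytope d S)"
  shows "\<exists>(x, y) \<in> unique_sum_pairs S. F = convex hull {bit_vector d x, bit_vector d y}"
proof -
  have face: "F face_of bit_polytope d S" and dim: "affine_dimension F = 1"
    using F by (auto simp: polytope_edges_def)
  let ?V = "F \<inter> bit_vector d ` S"
  have F_eq: "F = convex hull ?V"
    using face unfolding bit_polytope_def by (rule face_of_convex_hull_eq_hull_Int)
  have "\<exists>p\<in>?V. \<exists>q\<in>?V. p \<noteq> q"
  proof (rule ccontr)
    assume "\<not> ?thesis"
    then obtain p where "?V \<subseteq> {p}"
      by blast
    then have "F \<subseteq> {p}"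
      using F_eq hull_mono[of ?V "{p}" convex] by simp
    then show False
      using dim_1_collinear(1)[OF dim] by blast
  qed
  then obtain x y where xy: "x \<in> S" "y \<in> S" "bit_vector d x \<in> F" "bit_vector d y \<in> F" "x < y"
    by (metis IntE image_iff linorder_neqE_nat)
  have only: "z = x \<or> z = y" if z: "z \<in> S" "bit_vector d z \<in> F" for z
  proof -
    have lt: "x < 2 ^ d" "y < 2 ^ d" "z < 2 ^ d"
      using S xy z by auto
    then have "bit_vector d x \<noteq> bit_vector d y"
      using xy bit_vector_eq_iff by auto
    then obtain t where "bit_vector d z - bit_vector d y = t *\<^sub>R (bit_vector d x - bit_vector d y)"
      using dim_1_collinear(2)[OF dim xy(3,4) z(2)] by blast
    then show ?thesis
      using bit_vectors_not_collinear lt xy(5) by blast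
  qed
  then have "?V = {bit_vector d x, bit_vector d y}"
    using xy by auto
  then have "F = convex hull {bit_vector d x, bit_vector d y}"
    using F_eq by simp
  moreover have "(x, y) \<in> unique_sum_pairs S"
  proof (rule unique_sum_pairsI)
    fix u v assume uv: "u \<in> S" "v \<in> S" "bit_sum u v = bit_sum x y"
    let ?m = "(1/2) *\<^sub>R (bit_vector d x + bit_vector d y)"
    have lt: "x < 2 ^ d" "y < 2 ^ d" "u < 2 ^ d" "v < 2 ^ d"
      using S xy uv by auto
    have "u \<noteq> v"
    proof
      assume "u = v"
      have "bit x i = bit y i" for i
        using fun_cong[OF uv(3), of i] \<open>u = v\<close> by (auto simp: bit_sum_def of_bool_def split: if_splits)
      then show False
        using xy(5) bit_eqI[of x y] by auto
    qed
    then have neq: "bit_vector d u \<noteq> bit_vector d v"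
      using bit_vector_eq_iff lt by simp
    have m: "?m = (1/2) *\<^sub>R (bit_vector d u + bit_vector d v)"
      using bit_vector_add_eq_if_bit_sum_eq[OF uv(3), of d] by simp
    have "?m \<in> open_segment (bit_vector d u) (bit_vector d v)"
      unfolding m using neq by (auto simp: in_segment scaleR_add_right intro!: exI[of _ "1/2"])
    moreover have "?m \<in> F"
      using face_of_imp_convex[OF face] xy(3,4) convexD[of F "bit_vector d x" "bit_vector d y" "1/2" "1/2"]
      by (simp add: scaleR_add_right)
    moreover have "bit_vector d u \<in> bit_polytope d S" "bit_vector d v \<in> bit_polytope d S"
      using uv by (auto simp: bit_polytope_def hull_inc)
    ultimately have "bit_vector d u \<in> F" "bit_vector d v \<in> F"
      using face_ofD[OF face] by blast+
    then show "u = x \<and> v = y \<or> u = y \<and> v = x"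
      using only uv \<open>u \<noteq> v\<close> by blast
  qed (use xy in auto)
  ultimately show ?thesis
    by blast
qed

lemma card_edges_bit_polytope_le:
  assumes "S \<subseteq> {..<2 ^ d}"
  shows "finite (polytope_edges (bit_polytope d S))"
    and "card (polytope_edges (bit_polytope d S)) \<le> card (unique_sum_pairs S)"
proof -
  have fin: "finite (unique_sum_pairs S)"
    using finite_subset[OF assms] by (intro finite_unique_sum_pairs) simp
  have sub: "polytope_edges (bit_polytope d S) \<subseteq>
      (\<lambda>(x, y). convex hull {bit_vector d x, bit_vector d y}) ` unique_sum_pairs S"
    using edge_bit_polytope[OF assms] by fastforce
  then show "finite (polytope_edges (bit_polytope d S))"
    using fin finite_surj by blast
  show "card (polytope_edges (bit_polytope d S)) \<le> card (unique_sum_pairs S)"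
    using surj_card_le[OF fin sub] .
qed

section \<open>Edge expansion\<close>

lemma edge_expansion_ge_1I:
  assumes fin: "finite V" "finite E" and V2: "2 \<le> card V"
    and exp: "expanding (\<lambda>u v. {u, v} \<in> E) V"
  shows "edge_expansion V E \<ge> 1"
proof -
  let ?R = "\<lambda>u v. {u, v} \<in> E"
  let ?ok = "\<lambda>T. T \<subseteq> V \<and> 0 < card T \<and> real (card T) \<le> real (card V) / 2"
  let ?X = "{real (card (cut_edges V E T)) / real (card T) |T. ?ok T}"
  have "?X = (\<lambda>T. real (card (cut_edges V E T)) / real (card T)) ` {T \<in> Pow V. ?ok T}"
    by auto
  then have finX: "finite ?X"
    using fin by simp
  have neX: "?X \<noteq> {}"
  proof -
    obtain v where "v \<in> V"
      using V2 by fastforce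
    then have "?ok {v}"
      using V2 by simp
    then show ?thesis by blast
  qed
  have "1 \<le> real (card (cut_edges V E T)) / real (card T)" if T: "?ok T" for T
  proof -
    have "(\<lambda>(u, v). {u, v}) ` cut_pairs ?R V T \<subseteq> cut_edges V E T"
      by (auto simp: cut_pairs_def cut_edges_def)
    moreover have "finite (cut_edges V E T)"
      using fin by (simp add: cut_edges_def)
    moreover have "inj_on (\<lambda>(u, v). {u, v}) (cut_pairs ?R V T)"
      by (rule inj_onI) (auto simp: cut_pairs_def doubleton_eq_iff)
    ultimately have "card (cut_pairs ?R V T) \<le> card (cut_edges V E T)"
      by (metis card_image card_mono)
    moreover have "min (card T) (card V - card T) \<le> card (cut_pairs ?R V T)"
      using exp T by (simp add: expanding_def)
    moreover have "card T \<le> card V - card T"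
      using T by linarith
    ultimately have "card T \<le> card (cut_edges V E T)"
      by linarith
    then show ?thesis
      using T by simp
  qed
  then have "\<forall>r\<in>?X. 1 \<le> r"
    by blast
  then show ?thesis
    unfolding edge_expansion_def Min_ge_iff[OF finX neX] .
qed

theorem theorem8:
  fixes d n :: nat
  assumes "0 < d" and "0 < n" and "d + 1 \<le> n" and "n \<le> 2 ^ d"
  shows "\<exists>P. zero_one_polytope P \<and> affine_dimension P = int d \<and>
           card (polytope_vertices P) = n \<and>
           card (polytope_edges P) \<le> (d + 4) * n \<and>
           edge_expansion (polytope_vertices P) (polytope_graph_edges P) \<ge> 1"
proof -
  obtain S where S: "S \<subseteq> {..<2 ^ d}" "card S = n" "0 \<in> S" "\<forall>i<d. 2 ^ i \<in> S"
    "card (unique_sum_pairs S) \<le> d * n" "expanding (exposed_pair d S) S"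
    using vertex_code_exists[OF assms(3,4)] by blast
  let ?P = "bit_polytope d S"
  have fin: "finite S"
    using finite_subset[OF S(1)] by simp
  have inj: "inj_on (bit_vector d) S"
    using S(1) bit_vector_eq_iff by (intro inj_onI) (metis lessThan_iff subsetD)
  have card_V: "card (bit_vector d ` S) = n"
    using card_image[OF inj] S(2) by simp
  have "card (polytope_edges ?P) \<le> d * n"
    using card_edges_bit_polytope_le(2)[OF S(1)] S(5) by simp
  then have few: "card (polytope_edges ?P) \<le> (d + 4) * n"
    by (simp add: distrib_right)
  let ?E = "polytope_graph_edges ?P"
  have "expanding (\<lambda>p q. {p, q} \<in> ?E) (bit_vector d ` S)"
    using graph_edge_if_exposed_pair[OF S(1)] by (rule expanding_image[OF S(6) inj fin])
  moreover have "finite ?E"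
    using card_edges_bit_polytope_le(1)[OF S(1)] by (simp add: polytope_graph_edges_def)
  ultimately have "edge_expansion (bit_vector d ` S) ?E \<ge> 1"
    using fin card_V assms(1,3) by (intro edge_expansion_ge_1I) auto
  then show ?thesis
    using zero_one_bit_polytope affine_dimension_bit_polytope[of S d] S(3,4) card_V few
    by (intro exI[of _ ?P]) (simp add: vertices_bit_polytope[OF S(1)])
qed

end
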